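(* For every $K\in\mathcal{K}$, the Fréchet subdifferential of $J$ at $K$ is $$\partial J(K)=\operatorname{conv}\left\{\nabla_K\varphi(\theta,K)\mid\theta\in\Theta_0(K)\right\},$$ where for $\theta=(\omega,u,v)\in\Theta$, $$\nabla_K\varphi(\theta,K)=\mathrm{Re}\left[C\,\Gamma_{(K,\omega)}B_w\,u v^{\mathsf H}\left(\begin{bmatrix}0\\ R^{1/2}\end{bmatrix}+\begin{bmatrix}Q^{1/2}\\ R^{1/2}KC\end{bmatrix}\Gamma_{(K,\omega)}B\right)\right]^{\mathsf T},\qquad \Gamma_{(K,\omega)}=\left(e^{j\omega}I-(A+BKC)\right)^{-1}.$$
   Context: Fix $A\in\mathbb{R}^{n_x\times n_x}$, $B\in\mathbb{R}^{n_x\times n_u}$, $B_w\in\mathbb{R}^{n_x\times n_w}$, $C\in\mathbb{R}^{n_y\times n_x}$ and symmetric matrices $Q\in\mathbb{R}^{n_x\times n_x}$, $R\in\mathbb{R}^{n_u\times n_u}$. Standing assumptions: $(A,B)$ is stabilizable; $B_w$ and $C$ have full row rank; $Q$ and $R$ are positive definite; and $\mathcal{K}:=\{K\in\mathbb{R}^{n_u\times n_y}\mid \text{all eigenvalues of } A+BKC \text{ have modulus}<1\}$ is nonempty. For $K\in\mathcal{K}$ and $\omega\in[0,2\pi]$ let $$\mathbf{T}_{zw}(K,\omega)=\begin{bmatrix}Q^{1/2}\\ R^{1/2}KC\end{bmatrix}\left(e^{j\omega}I-(A+BKC)\right)^{-1}B_w,\qquad J(K):=\max_{\omega\in[0,2\pi]}\sigma_{\max}(\mathbf{T}_{zw}(K,\omega)),$$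 where $j$ is the imaginary unit and $\sigma_{\max}$ the largest singular value. Let $$\Theta:=[0,2\pi]\times\{u\in\mathbb{C}^{n_w}:\|u\|=1\}\times\{v\in\mathbb{C}^{n_x+n_u}:\|v\|=1\},$$ $\varphi(\theta,K):=\mathrm{Re}\left[v^{\mathsf H}\mathbf{T}_{zw}(K,\omega)u\right]$ for $\theta=(\omega,u,v)\in\Theta$, and $\Theta_0(K):=\{\theta\in\Theta\mid\varphi(\theta,K)=J(K)\}$. Here $\mathsf H$ is conjugate transpose, $\mathsf T$ transpose, $\mathrm{Re}$ the entrywise real part, and $\operatorname{conv}$ the convex hull; gradients are with respect to the trace inner product on $\mathbb{R}^{n_u\times n_y}$. The Fréchet subdifferential of a locally Lipschitz function $f$ on an open set at $\bar x$ is $\partial f(\bar x)=\{v\mid\liminf_{y\to\bar x,\,y\ne\bar x}\frac{f(y)-f(\bar x)-\langle v,y-\bar x\rangle}{\|y-\bar x\|}\ge 0\}$. *)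

theory Defs
  imports "HOL-Analysis.Analysis"
begin

abbreviation cmat :: "real^'n^'m \<Rightarrow> complex^'n^'m" where
  "cmat \<equiv> map_matrix complex_of_real"

definition Re_mat :: "complex^'n^'m \<Rightarrow> real^'n^'m" where
  "Re_mat = map_matrix Re"

definition ctranspose :: "complex^'n^'m \<Rightarrow> complex^'m^'n" where
  "ctranspose M = map_matrix cnj (transpose M)"

text \<open>The product \<open>v\<^sup>H w\<close>; it is conjugate-linear in the first argument.\<close>
definition cdot :: "complex^'n \<Rightarrow> complex^'n \<Rightarrow> complex" where
  "cdot v w = (\<Sum>i\<in>UNIV. cnj (v $ i) * w $ i)"

text \<open>The rank-one matrix \<open>u v\<^sup>H\<close>.\<close>
definition couter :: "complex^'m \<Rightarrow> complex^'n \<Rightarrow> complex^'n^'m" where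
  "couter u v = (\<chi> i j. u $ i * cnj (v $ j))"

text \<open>The block column with \<open>M\<close> on top of \<open>N\<close>; rows are indexed by a sum type.\<close>
definition vstack :: "'a^'n^'m \<Rightarrow> 'a^'n^'k \<Rightarrow> 'a^'n^('m + 'k)" where
  "vstack M N = (\<chi> i. case i of Inl a \<Rightarrow> M $ a | Inr b \<Rightarrow> N $ b)"

definition eigenvalue :: "complex^'n^'n \<Rightarrow> complex \<Rightarrow> bool" where
  "eigenvalue M \<mu> \<longleftrightarrow> (\<exists>x. x \<noteq> 0 \<and> M *v x = \<mu> *s x)"

text \<open>
  Singular values of \<open>M\<close> are the square roots of the eigenvalues of \<open>M\<^sup>H M\<close>. For a wide matrix
  this list is longer than the usual one only by zeros, which does not affect the maximum.
\<close>
definition sigma_max :: "complex^'n^'m \<Rightarrow> real" where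
  "sigma_max M =
     Max {s. 0 \<le> s \<and> eigenvalue (ctranspose M ** M) (complex_of_real (s\<^sup>2))}"

definition pos_def :: "real^'n^'n \<Rightarrow> bool" where
  "pos_def M \<longleftrightarrow> transpose M = M \<and> (\<forall>x. x \<noteq> 0 \<longrightarrow> 0 < x \<bullet> (M *v x))"

definition pos_semidef :: "real^'n^'n \<Rightarrow> bool" where
  "pos_semidef M \<longleftrightarrow> transpose M = M \<and> (\<forall>x. 0 \<le> x \<bullet> (M *v x))"

text \<open>The principal square root \<open>M^(1/2)\<close> of a positive semidefinite matrix.\<close>
definition mat_sqrt :: "real^'n^'n \<Rightarrow> real^'n^'n" where
  "mat_sqrt M = (THE S. pos_semidef S \<and> S ** S = M)"

definition schur_stable :: "real^'n^'n \<Rightarrow> bool" where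
  "schur_stable M \<longleftrightarrow> (\<forall>\<mu>. eigenvalue (cmat M) \<mu> \<longrightarrow> cmod \<mu> < 1)"

definition stabilizable :: "real^'x^'x \<Rightarrow> real^'u^'x \<Rightarrow> bool" where
  "stabilizable A B \<longleftrightarrow> (\<exists>F :: real^'x^'u. schur_stable (A + B ** F))"

text \<open>The set \<open>\<K>\<close> of stabilizing static output-feedback gains.\<close>
definition stabilizing_gains ::
  "real^'x^'x \<Rightarrow> real^'u^'x \<Rightarrow> real^'x^'y \<Rightarrow> (real^'y^'u) set" where
  "stabilizing_gains A B C = {K. schur_stable (A + B ** K ** C)}"

definition resolvent ::
  "real^'x^'x \<Rightarrow> real^'u^'x \<Rightarrow> real^'x^'y \<Rightarrow> real^'y^'u \<Rightarrow> real \<Rightarrow> complex^'x^'x" where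
  "resolvent A B C K \<omega> =
     matrix_inv (mat (exp (\<i> * complex_of_real \<omega>)) - cmat (A + B ** K ** C))"

definition output_mat ::
  "real^'x^'y \<Rightarrow> real^'x^'x \<Rightarrow> real^'u^'u \<Rightarrow> real^'y^'u \<Rightarrow> real^'x^('x + 'u)" where
  "output_mat C Q R K = vstack (mat_sqrt Q) (mat_sqrt R ** K ** C)"

definition T_zw ::
  "real^'x^'x \<Rightarrow> real^'u^'x \<Rightarrow> real^'w^'x \<Rightarrow> real^'x^'y \<Rightarrow> real^'x^'x \<Rightarrow> real^'u^'u
    \<Rightarrow> real^'y^'u \<Rightarrow> real \<Rightarrow> complex^'w^('x + 'u)" where
  "T_zw A B Bw C Q R K \<omega> = cmat (output_mat C Q R K) ** resolvent A B C K \<omega> ** cmat Bw"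

text \<open>
  For stabilizing \<open>K\<close> the supremum is attained, since the frequency response is continuous on
  the compact interval.
\<close>
definition J_cost ::
  "real^'x^'x \<Rightarrow> real^'u^'x \<Rightarrow> real^'w^'x \<Rightarrow> real^'x^'y \<Rightarrow> real^'x^'x \<Rightarrow> real^'u^'u
    \<Rightarrow> real^'y^'u \<Rightarrow> real" where
  "J_cost A B Bw C Q R K = (SUP \<omega>\<in>{0..2*pi}. sigma_max (T_zw A B Bw C Q R K \<omega>))"

definition Theta :: "(real \<times> (complex^'w) \<times> (complex^('x::finite + 'u::finite))) set" where
  "Theta = {0..2*pi} \<times> {u. norm u = 1} \<times> {v. norm v = 1}"

definition phi ::
  "real^'x^'x \<Rightarrow> real^'u^'x \<Rightarrow> real^'w^'x \<Rightarrow> real^'x^'y \<Rightarrow> real^'x^'x \<Rightarrow> real^'u^'u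
    \<Rightarrow> real \<times> (complex^'w) \<times> (complex^('x + 'u)) \<Rightarrow> real^'y^'u \<Rightarrow> real" where
  "phi A B Bw C Q R = (\<lambda>(\<omega>, u, v) K. Re (cdot v (T_zw A B Bw C Q R K \<omega> *v u)))"

definition Theta0 ::
  "real^'x^'x \<Rightarrow> real^'u^'x \<Rightarrow> real^'w^'x \<Rightarrow> real^'x^'y \<Rightarrow> real^'x^'x \<Rightarrow> real^'u^'u
    \<Rightarrow> real^'y^'u \<Rightarrow> (real \<times> (complex^'w) \<times> (complex^('x + 'u))) set" where
  "Theta0 A B Bw C Q R K =
     {\<theta> \<in> Theta. phi A B Bw C Q R \<theta> K = J_cost A B Bw C Q R K}"

text \<open>
  The closed-form expression for the gradient of \<open>phi\<close> in the gain; that it is the gradient is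
  a claim of the theorem, not part of the definition.
\<close>
definition grad_phi ::
  "real^'x^'x \<Rightarrow> real^'u^'x \<Rightarrow> real^'w^'x \<Rightarrow> real^'x^'y \<Rightarrow> real^'x^'x \<Rightarrow> real^'u^'u
    \<Rightarrow> real \<times> (complex^'w) \<times> (complex^('x + 'u)) \<Rightarrow> real^'y^'u \<Rightarrow> real^'y^'u" where
  "grad_phi A B Bw C Q R = (\<lambda>(\<omega>, u, v) K.
     transpose (Re_mat
       (cmat C ** resolvent A B C K \<omega> ** cmat Bw ** couter u v **
         (cmat (vstack 0 (mat_sqrt R))
           + cmat (output_mat C Q R K) ** resolvent A B C K \<omega> ** cmat B))))"

text \<open>
  Intended for open \<open>S\<close>. On matrices, \<open>\<bullet>\<close> is the trace inner product
  \<open>\<Sum>\<^sub>i \<Sum>\<^sub>j v\<^sub>i\<^sub>j y\<^sub>i\<^sub>j\<close> and \<open>norm\<close> is the Frobenius norm.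
\<close>
definition frechet_subdifferential ::
  "'a::real_inner set \<Rightarrow> ('a \<Rightarrow> real) \<Rightarrow> 'a \<Rightarrow> 'a set" where
  "frechet_subdifferential S f x =
     {v. 0 \<le> Liminf (at x within S)
               (\<lambda>y. ereal ((f y - f x - v \<bullet> (y - x)) / norm (y - x)))}"

end

theory Submission
  imports Defs
begin

text \<open>
  The cost is a maximum of smooth functions: since \<open>\<sigma>\<^sub>m\<^sub>a\<^sub>x M\<close> is the largest value of
  \<open>Re (v\<^sup>H M u)\<close> over unit vectors, \<open>J\<close> is the maximum of \<open>\<phi>(\<theta>, \<cdot>)\<close> over the compact set \<open>\<Theta>\<close>
  (\<open>sigma_max_variational\<close>, \<open>J_cost_max\<close>). The claim is then a theorem of Danskin type for such
  maxima (\<open>frechet_subdifferential_max\<close>): every gradient of an active function is a Frechet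
  subgradient because \<open>J\<close> lies above that function and touches it at \<open>K\<close>. Conversely, if a
  subgradient were outside the compact convex hull of the active gradients, a hyperplane would
  separate it. Moving from \<open>K\<close> in the separating direction and choosing maximizers along the way, a
  convergent subsequence of them yields an active \<open>\<theta>\<close> whose gradient lies on the same side of the
  hyperplane as the subgradient, a contradiction.

  Differentiability enters only through a Caratheodory slope: a function \<open>P\<close>, continuous, with
  \<open>\<phi>(\<theta>, L) - \<phi>(\<theta>, K) = \<langle>P(\<theta>, L), L - K\<rangle>\<close>. Its value at \<open>L = K\<close> is the gradient, and the same
  identity gives exactly the increments that the Danskin argument needs. For the
  transfer function this slope is explicit. The resolvent identity
  \<open>\<Gamma>\<^sub>L - \<Gamma>\<^sub>K = \<Gamma>\<^sub>L B (L - K) C \<Gamma>\<^sub>K\<close> writes the increment of \<open>T\<^sub>z\<^sub>w\<close> as a product with \<open>L - K\<close> in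
  the middle, and the trace inner product turns \<open>v\<^sup>H (\<cdot>) u\<close> of it into the formula for the gradient,
  with \<open>K\<close> replaced by \<open>L\<close> in the left factor (\<open>phi_difference\<close>). Continuity follows from Cramer's
  rule for the inverse, and the stabilizing gains form an open set (\<open>open_stabilizing_gains\<close>).
\<close>

section \<open>Frechet subdifferentials of maxima\<close>

lemma mem_frechet_subdifferential:
  "v \<in> frechet_subdifferential S f x \<longleftrightarrow>
    (\<forall>e>0. \<forall>\<^sub>F y in at x within S. - e * norm (y - x) \<le> f y - f x - v \<bullet> (y - x))"
    (is "_ \<longleftrightarrow> ?R")
proof -
  let ?q = "\<lambda>y. (f y - f x - v \<bullet> (y - x)) / norm (y - x)"
  have nz: "\<forall>\<^sub>F y in at x within S. norm (y - x) > 0"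
    by (auto simp: eventually_at intro: exI[of _ 1])
  have "v \<in> frechet_subdifferential S f x \<longleftrightarrow>
      (\<forall>c<0. \<forall>\<^sub>F y in at x within S. c < ereal (?q y))"
    unfolding frechet_subdifferential_def by (simp add: le_Liminf_iff)
  also have "\<dots> \<longleftrightarrow> ?R"
  proof (intro iffI allI impI)
    fix e :: real assume *: "\<forall>c<0. \<forall>\<^sub>F y in at x within S. c < ereal (?q y)" and "e > 0"
    then have "\<forall>\<^sub>F y in at x within S. ereal (-e) < ereal (?q y)"
      by (intro *[rule_format]) simp
    with nz show "\<forall>\<^sub>F y in at x within S. - e * norm (y - x) \<le> f y - f x - v \<bullet> (y - x)"
    proof eventually_elim
      case (elim y)
      from elim(2) have "- e < ?q y" by simp
      with elim(1) have "- e * norm (y - x) < f y - f x - v \<bullet> (y - x)"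
        by (simp only: pos_less_divide_eq)
      then show ?case by (rule less_imp_le)
    qed
  next
    fix c :: ereal assume R: ?R and "c < 0"
    then obtain r where r: "c < ereal r" "r < 0"
      using ereal_dense2[of c 0] by (auto simp: zero_ereal_def)
    have "\<forall>\<^sub>F y in at x within S. - (- r) * norm (y - x) \<le> f y - f x - v \<bullet> (y - x)"
      using r(2) by (intro R[rule_format]) simp
    with nz show "\<forall>\<^sub>F y in at x within S. c < ereal (?q y)"
    proof eventually_elim
      case (elim y)
      then have "r \<le> ?q y" by (simp only: pos_le_divide_eq minus_minus)
      then show ?case using r(1) by (meson ereal_less_eq(3) less_le_trans)
    qed
  qed
  finally show ?thesis .
qed

lemma convex_frechet_subdifferential: "convex (frechet_subdifferential S f x)"
proof (rule convexI)
  fix v w and s t :: real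
  assume v: "v \<in> frechet_subdifferential S f x" and w: "w \<in> frechet_subdifferential S f x"
    and st: "0 \<le> s" "0 \<le> t" "s + t = 1"
  show "s *\<^sub>R v + t *\<^sub>R w \<in> frechet_subdifferential S f x"
    unfolding mem_frechet_subdifferential
  proof (intro allI impI)
    fix e :: real assume "e > 0"
    with v w have "\<forall>\<^sub>F y in at x within S. - e * norm (y - x) \<le> f y - f x - v \<bullet> (y - x)"
      "\<forall>\<^sub>F y in at x within S. - e * norm (y - x) \<le> f y - f x - w \<bullet> (y - x)"
      unfolding mem_frechet_subdifferential by auto
    then show "\<forall>\<^sub>F y in at x within S. - e * norm (y - x) \<le> f y - f x - (s *\<^sub>R v + t *\<^sub>R w) \<bullet> (y - x)"
    proof eventually_elim
      case (elim y)
      have "(s + t) * (- e * norm (y - x))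
          \<le> s * (f y - f x - v \<bullet> (y - x)) + t * (f y - f x - w \<bullet> (y - x))"
        using mult_left_mono[OF elim(1) st(1)] mult_left_mono[OF elim(2) st(2)]
        by (simp only: distrib_right)
      also have "\<dots> = (s + t) * (f y - f x) - (s *\<^sub>R v + t *\<^sub>R w) \<bullet> (y - x)"
        by (simp add: inner_add_left algebra_simps)
      finally show ?case by (simp add: st)
    qed
  qed
qed

text \<open>
  Caratheodory's form of differentiability: the error term \<open>(p y - p x) \<bullet> (y - x)\<close> is of smaller
  order than \<open>y - x\<close> by continuity of \<open>p\<close>.
\<close>
lemma GDERIV_if_slope:
  fixes f :: "'a::real_inner \<Rightarrow> real"
  assumes "open U" "x \<in> U" and cont: "continuous_on U p"
    and slope: "\<And>y. y \<in> U \<Longrightarrow> f y - f x = p y \<bullet> (y - x)"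
  shows "GDERIV f x :> p x"
  unfolding gderiv_def has_derivative_at_alt
proof (intro conjI allI impI)
  show "bounded_linear (\<lambda>h. h \<bullet> p x)" by (rule bounded_linear_inner_left)
  fix e :: real assume "0 < e"
  with cont \<open>open U\<close> \<open>x \<in> U\<close> obtain d where d: "d > 0" "\<And>y. dist y x < d \<Longrightarrow> dist (p y) (p x) < e"
    unfolding continuous_on_eq_continuous_at[OF \<open>open U\<close>] continuous_at_eps_delta by metis
  obtain r where r: "r > 0" "ball x r \<subseteq> U" using \<open>open U\<close> \<open>x \<in> U\<close> openE by blast
  show "\<exists>d>0. \<forall>y. norm (y - x) < d \<longrightarrow> norm (f y - f x - (y - x) \<bullet> p x) \<le> e * norm (y - x)"
  proof (intro exI[of _ "min d r"] conjI allI impI)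
    fix y assume y: "norm (y - x) < min d r"
    then have "y \<in> U" using r by (auto simp: dist_norm norm_minus_commute)
    then have "f y - f x - (y - x) \<bullet> p x = (p y - p x) \<bullet> (y - x)"
      using slope by (simp add: inner_diff inner_commute)
    also have "norm \<dots> \<le> norm (p y - p x) * norm (y - x)"
      by (simp add: Cauchy_Schwarz_ineq2)
    also have "\<dots> \<le> e * norm (y - x)"
      using d(2)[of y] y by (intro mult_right_mono) (auto simp: dist_norm)
    finally show "norm (f y - f x - (y - x) \<bullet> p x) \<le> e * norm (y - x)" .
  qed (use d r in auto)
qed

text \<open>
  A Danskin theorem with Caratheodory slopes \<open>P \<theta>\<close> based at \<open>x\<close> in place of gradients near \<open>x\<close>.
  Joint continuity of the slopes makes the active set and the set of its gradients compact, and it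
  allows the passage to the limit along maximizers at points approaching \<open>x\<close>.
\<close>
lemma frechet_subdifferential_max:
  fixes P :: "'p::metric_space \<Rightarrow> 'a::euclidean_space \<Rightarrow> 'a" and \<phi> :: "'p \<Rightarrow> 'a \<Rightarrow> real"
  assumes "compact T" "open S" "x \<in> S"
    and slope: "\<And>\<theta> y. \<theta> \<in> T \<Longrightarrow> y \<in> S \<Longrightarrow> \<phi> \<theta> y - \<phi> \<theta> x = P \<theta> y \<bullet> (y - x)"
    and contP: "continuous_on (T \<times> S) (\<lambda>(\<theta>, y). P \<theta> y)"
    and cont\<phi>: "continuous_on T (\<lambda>\<theta>. \<phi> \<theta> x)"
    and le: "\<And>\<theta> y. \<theta> \<in> T \<Longrightarrow> y \<in> S \<Longrightarrow> \<phi> \<theta> y \<le> f y"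
    and att: "\<And>y. y \<in> S \<Longrightarrow> \<exists>\<theta>\<in>T. \<phi> \<theta> y = f y"
  shows "frechet_subdifferential S f x = convex hull {P \<theta> x | \<theta>. \<theta> \<in> T \<and> \<phi> \<theta> x = f x}"
proof
  let ?T0 = "{\<theta> \<in> T. \<phi> \<theta> x = f x}"
  have set_eq: "{P \<theta> x | \<theta>. \<theta> \<in> T \<and> \<phi> \<theta> x = f x} = (\<lambda>\<theta>. P \<theta> x) ` ?T0"
    by auto
  have contPx: "continuous_on T (\<lambda>\<theta>. P \<theta> x)"
  proof -
    have "continuous_on T (\<lambda>\<theta>. (\<theta>, x))" by (intro continuous_intros)
    from continuous_on_compose2[OF contP this] show ?thesis using \<open>x \<in> S\<close> by auto
  qed
  show "convex hull {P \<theta> x | \<theta>. \<theta> \<in> T \<and> \<phi> \<theta> x = f x} \<subseteq> frechet_subdifferential S f x"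
  proof (rule hull_minimal; (rule convex_frechet_subdifferential)?)
    show "{P \<theta> x | \<theta>. \<theta> \<in> T \<and> \<phi> \<theta> x = f x} \<subseteq> frechet_subdifferential S f x"
    proof clarify
      fix \<theta> assume \<theta>: "\<theta> \<in> T" "\<phi> \<theta> x = f x"
      show "P \<theta> x \<in> frechet_subdifferential S f x"
        unfolding mem_frechet_subdifferential
      proof (intro allI impI)
        fix e :: real assume "e > 0"
        have "continuous_on S (\<lambda>y. P \<theta> y)"
        proof -
          have "continuous_on S (\<lambda>y. (\<theta>, y))" by (intro continuous_intros)
          from continuous_on_compose2[OF contP this] show ?thesis using \<theta>(1) by auto
        qed
        then have "((\<lambda>y. P \<theta> y) \<longlongrightarrow> P \<theta> x) (at x within S)"
          using \<open>x \<in> S\<close> by (auto simp: continuous_on_def)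
        then have "\<forall>\<^sub>F y in at x within S. dist (P \<theta> y) (P \<theta> x) < e"
          using \<open>e > 0\<close> by (rule tendstoD)
        moreover have "\<forall>\<^sub>F y in at x within S. y \<in> S"
          by (simp add: eventually_at_filter)
        ultimately show "\<forall>\<^sub>F y in at x within S. - e * norm (y - x) \<le> f y - f x - P \<theta> x \<bullet> (y - x)"
        proof eventually_elim
          case (elim y)
          have "\<bar>(P \<theta> y - P \<theta> x) \<bullet> (y - x)\<bar> \<le> norm (P \<theta> y - P \<theta> x) * norm (y - x)"
            by (rule Cauchy_Schwarz_ineq2)
          also have "\<dots> \<le> e * norm (y - x)"
            using elim by (intro mult_right_mono) (auto simp: dist_norm)
          finally have "- e * norm (y - x) \<le> (P \<theta> y - P \<theta> x) \<bullet> (y - x)" by linarith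
          also have "\<dots> = \<phi> \<theta> y - \<phi> \<theta> x - P \<theta> x \<bullet> (y - x)"
            using slope[OF \<theta>(1) elim(2)] by (simp add: inner_diff_left)
          also have "\<dots> \<le> f y - f x - P \<theta> x \<bullet> (y - x)"
            using le[OF \<theta>(1) elim(2)] \<theta>(2) by simp
          finally show ?case .
        qed
      qed
    qed
  qed
  show "frechet_subdifferential S f x \<subseteq> convex hull {P \<theta> x | \<theta>. \<theta> \<in> T \<and> \<phi> \<theta> x = f x}"
  proof (rule subsetI, rule ccontr)
    fix v assume v: "v \<in> frechet_subdifferential S f x"
      and nin: "v \<notin> convex hull {P \<theta> x | \<theta>. \<theta> \<in> T \<and> \<phi> \<theta> x = f x}"
    have "closed ?T0"
      by (rule continuous_closed_preimage_constant[OF cont\<phi> compact_imp_closed[OF \<open>compact T\<close>]])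
    then have "compact (T \<inter> ?T0)" by (rule compact_Int_closed[OF \<open>compact T\<close>])
    also have "T \<inter> ?T0 = ?T0" by blast
    finally have "compact ?T0" .
    then have "compact ((\<lambda>\<theta>. P \<theta> x) ` ?T0)"
      by (intro compact_continuous_image continuous_on_subset[OF contPx]) auto
    then have "closed (convex hull ((\<lambda>\<theta>. P \<theta> x) ` ?T0))"
      by (intro compact_imp_closed compact_convex_hull)
    from separating_hyperplane_closed_point[OF convex_convex_hull this nin[unfolded set_eq]]
    obtain a b where ab: "a \<bullet> v < b" "\<And>w. w \<in> convex hull ((\<lambda>\<theta>. P \<theta> x) ` ?T0) \<Longrightarrow> a \<bullet> w > b"
      by blast
    have sep: "P \<theta> x \<bullet> (- a) < v \<bullet> (- a)" if "\<theta> \<in> ?T0" for \<theta>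
    proof -
      have "P \<theta> x \<in> convex hull ((\<lambda>\<theta>. P \<theta> x) ` ?T0)" by (intro hull_inc imageI that)
      from ab(1) ab(2)[OF this] show ?thesis by (simp add: inner_commute[of a])
    qed
    define d where "d = - a"
    obtain \<theta>1 where \<theta>1: "\<theta>1 \<in> T" "\<phi> \<theta>1 x = f x" using att \<open>x \<in> S\<close> by blast
    have "d \<noteq> 0" using sep[of \<theta>1] \<theta>1 by (auto simp: d_def)
    obtain r where r: "r > 0" "ball x r \<subseteq> S" using \<open>open S\<close> \<open>x \<in> S\<close> openE by blast
    \<comment> \<open>The factor \<open>r / (2 * norm d)\<close> keeps all points \<open>y n\<close> in the ball of radius \<open>r\<close> around \<open>x\<close>.\<close>
    define t where "t n = r / (2 * norm d) / real (Suc n)" for n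
    define y where "y n = x + t n *\<^sub>R d" for n
    have t_pos: "t n > 0" for n using r(1) \<open>d \<noteq> 0\<close> by (simp add: t_def)
    have "t = (\<lambda>n. r / (2 * norm d) * inverse (real (Suc n)))"
      by (rule ext) (simp only: t_def divide_inverse)
    then have "t \<longlonglongrightarrow> 0"
      using tendsto_mult_left[OF LIMSEQ_inverse_real_of_nat, of "r / (2 * norm d)"] by simp
    then have "(\<lambda>n. x + t n *\<^sub>R d) \<longlonglongrightarrow> x + 0 *\<^sub>R d"
      by (intro tendsto_add tendsto_scaleR tendsto_const)
    then have y_lim: "y \<longlonglongrightarrow> x" by (simp add: y_def[abs_def])
    have yS: "y n \<in> S" for n
    proof -
      have "norm (t n *\<^sub>R d) = t n * norm d" using t_pos[of n] by simp
      also have "\<dots> = r / 2 / real (Suc n)" unfolding t_def using \<open>d \<noteq> 0\<close> by simp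
      also have "\<dots> \<le> r / 2 / 1" using r(1) by (intro divide_left_mono) auto
      also have "\<dots> < r" using r(1) by simp
      finally have "y n \<in> ball x r" by (simp add: y_def dist_norm)
      then show ?thesis using r by blast
    qed
    have "\<exists>\<theta>. \<theta> \<in> T \<and> \<phi> \<theta> (y n) = f (y n)" for n using att[OF yS] by blast
    then have "\<exists>\<theta>. \<forall>n. \<theta> n \<in> T \<and> \<phi> (\<theta> n) (y n) = f (y n)" by (intro choice allI)
    then obtain \<theta> where \<theta>: "\<And>n. \<theta> n \<in> T" "\<And>n. \<phi> (\<theta> n) (y n) = f (y n)" by blast
    obtain \<theta>' s where s: "\<theta>' \<in> T" "strict_mono s" "(\<theta> \<circ> s) \<longlonglongrightarrow> \<theta>'"
      by (rule seq_compactE[OF compact_imp_seq_compact[OF \<open>compact T\<close>], of \<theta>]) (use \<theta>(1) in auto)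
    have ys: "(\<lambda>n. y (s n)) \<longlonglongrightarrow> x" using LIMSEQ_subseq_LIMSEQ[OF y_lim s(2)] by (simp add: o_def)
    have \<theta>s: "(\<lambda>n. \<theta> (s n)) \<longlonglongrightarrow> \<theta>'" using s(3) by (simp add: o_def)
    have P_lim: "(\<lambda>n. P (\<theta> (s n)) (y (s n))) \<longlonglongrightarrow> P \<theta>' x"
      using continuous_on_tendsto_compose[OF contP tendsto_Pair[OF \<theta>s ys]] s(1) \<open>x \<in> S\<close> \<theta>(1) yS
      by auto
    have \<phi>x_lim: "(\<lambda>n. \<phi> (\<theta> (s n)) x) \<longlonglongrightarrow> \<phi> \<theta>' x"
      using continuous_on_tendsto_compose[OF cont\<phi> \<theta>s] s(1) \<theta>(1) by auto
    have "(\<lambda>n. \<phi> (\<theta> (s n)) x + P (\<theta> (s n)) (y (s n)) \<bullet> (y (s n) - x)) \<longlonglongrightarrow>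
        \<phi> \<theta>' x + P \<theta>' x \<bullet> (x - x)"
      by (intro tendsto_add tendsto_inner tendsto_diff \<phi>x_lim P_lim ys tendsto_const)
    moreover have "\<phi> (\<theta> (s n)) x + P (\<theta> (s n)) (y (s n)) \<bullet> (y (s n) - x) = f (y (s n))" for n
      using slope[OF \<theta>(1) yS, of "s n" "s n"] \<theta>(2)[of "s n"] by simp
    ultimately have f_lim: "(\<lambda>n. f (y (s n))) \<longlonglongrightarrow> \<phi> \<theta>' x" by simp
    \<comment> \<open>The limit of maximizers at \<open>y n\<close> is a maximizer at \<open>x\<close>: compare with the fixed maximizer \<open>\<theta>1\<close>.\<close>
    have P1_lim: "(\<lambda>n. P \<theta>1 (y (s n))) \<longlonglongrightarrow> P \<theta>1 x"
      using continuous_on_tendsto_compose[OF contP tendsto_Pair[OF tendsto_const ys], of \<theta>1]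
        \<theta>1 \<open>x \<in> S\<close> yS by auto
    have "(\<lambda>n. \<phi> \<theta>1 x + P \<theta>1 (y (s n)) \<bullet> (y (s n) - x)) \<longlonglongrightarrow> \<phi> \<theta>1 x + P \<theta>1 x \<bullet> (x - x)"
      by (intro tendsto_add tendsto_inner tendsto_diff P1_lim ys tendsto_const)
    moreover have "\<phi> \<theta>1 x + P \<theta>1 (y (s n)) \<bullet> (y (s n) - x) \<le> f (y (s n))" for n
      using slope[OF \<theta>1(1) yS, of "s n"] le[OF \<theta>1(1) yS, of "s n"] by simp
    ultimately have "\<phi> \<theta>1 x \<le> \<phi> \<theta>' x"
      using LIMSEQ_le[OF _ f_lim] by simp
    then have \<theta>'0: "\<theta>' \<in> ?T0" using \<theta>1 s(1) le[OF s(1) \<open>x \<in> S\<close>] by auto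
    \<comment> \<open>Half of the separation gap, so that the error in the subgradient inequality cannot close it.\<close>
    define e where "e = (v \<bullet> d - P \<theta>' x \<bullet> d) / (2 * norm d)"
    have gap: "P \<theta>' x \<bullet> d < v \<bullet> d" using sep[OF \<theta>'0] by (simp add: d_def)
    then have "e > 0" using \<open>d \<noteq> 0\<close> by (simp add: e_def)
    have "y n \<noteq> x" for n using t_pos[of n] \<open>d \<noteq> 0\<close> by (simp add: y_def)
    then have "\<forall>\<^sub>F n in sequentially. y (s n) \<in> S \<and> y (s n) \<noteq> x"
      using yS by simp
    then have "filterlim (\<lambda>n. y (s n)) (at x within S) sequentially"
      using ys by (simp add: filterlim_at)
    from eventually_compose_filterlim[OF
        v[unfolded mem_frechet_subdifferential, rule_format, OF \<open>e > 0\<close>] this]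
    have "\<forall>\<^sub>F n in sequentially. v \<bullet> d - e * norm d \<le> P (\<theta> (s n)) (y (s n)) \<bullet> d"
    proof eventually_elim
      case (elim n)
      let ?t = "t (s n)"
      have "f (y (s n)) - f x \<le> P (\<theta> (s n)) (y (s n)) \<bullet> (y (s n) - x)"
        using slope[OF \<theta>(1) yS, of "s n" "s n"] \<theta>(2)[of "s n"] le[OF \<theta>(1) \<open>x \<in> S\<close>, of "s n"]
        by simp
      moreover have "norm (y (s n) - x) = ?t * norm d" "y (s n) - x = ?t *\<^sub>R d"
        using t_pos[of "s n"] by (simp_all add: y_def)
      ultimately have "- e * (?t * norm d) \<le> ?t * (P (\<theta> (s n)) (y (s n)) \<bullet> d) - ?t * (v \<bullet> d)"
        using elim by (simp only: inner_scaleR_right)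
      then have "?t * (v \<bullet> d - e * norm d) \<le> ?t * (P (\<theta> (s n)) (y (s n)) \<bullet> d)"
        by (simp only: right_diff_distrib mult.left_commute[of e] mult_minus_left)
      then show ?case using t_pos[of "s n"] by (simp only: mult_le_cancel_left_pos)
    qed
    moreover have "(\<lambda>n. P (\<theta> (s n)) (y (s n)) \<bullet> d) \<longlonglongrightarrow> P \<theta>' x \<bullet> d"
      by (intro tendsto_inner P_lim tendsto_const)
    ultimately have "v \<bullet> d - e * norm d \<le> P \<theta>' x \<bullet> d"
      by (intro tendsto_lowerbound) auto
    then show False using gap \<open>d \<noteq> 0\<close> by (simp add: e_def field_simps)
  qed
qed

section \<open>The largest singular value as a maximum\<close>

lemma cdot_matrix_vector_mult: "cdot v (M *v x) = cdot (ctranspose M *v v) x"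
proof -
  have "cdot v (M *v x) = (\<Sum>i\<in>UNIV. \<Sum>j\<in>UNIV. cnj (v $ i) * M $ i $ j * x $ j)"
    by (simp add: cdot_def matrix_vector_mult_def sum_distrib_left mult.assoc)
  also have "\<dots> = (\<Sum>j\<in>UNIV. \<Sum>i\<in>UNIV. cnj (v $ i) * M $ i $ j * x $ j)"
    by (rule sum.swap)
  also have "\<dots> = cdot (ctranspose M *v v) x"
    by (simp add: cdot_def ctranspose_def transpose_def matrix_vector_mult_def sum_distrib_left
        sum_distrib_right ac_simps)
  finally show ?thesis .
qed

text \<open>
  The real part of the Hermitian product is the Euclidean inner product of \<open>complex^'n\<close> as a real
  space. Hence the real theory applies to self-adjoint complex matrices.
\<close>
lemma Re_cdot: "Re (cdot v w) = v \<bullet> w"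
  by (simp add: cdot_def inner_vec_def inner_complex_def)

lemma inner_cmatrix_vector_mult: "v \<bullet> (M *v x) = (ctranspose M *v v) \<bullet> x"
  for M :: "complex^'n^'m"
  by (metis Re_cdot cdot_matrix_vector_mult)

lemma gram_inner: "(ctranspose M ** M *v x) \<bullet> y = (M *v x) \<bullet> (M *v y)"
  for M :: "complex^'n^'m"
  by (metis inner_cmatrix_vector_mult inner_commute matrix_vector_mul_assoc)

lemma of_real_vector_scale: "complex_of_real c *s x = c *\<^sub>R x"
  by (simp add: vec_eq_iff scaleR_conv_of_real[where 'a=complex])

lemma cmatrix_vector_mult_scaleR: "M *v (c *\<^sub>R x) = c *\<^sub>R (M *v x)"
  for M :: "complex^'n^'m"
  by (simp add: linear_scale)

text \<open>
  The form \<open>q h = s\<^sup>2 \<bar>h\<bar>\<^sup>2 - \<bar>M h\<bar>\<^sup>2\<close> with \<open>s = \<bar>M w\<bar>\<close> is nonnegative and vanishes at \<open>w\<close>, so \<open>w\<close>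
  minimizes it and half its gradient \<open>g = s\<^sup>2 w - M\<^sup>H M w\<close> there is zero. Otherwise a step against
  \<open>g\<close> would make the form negative.
\<close>
lemma eigenvector_if_norm_maximal:
  fixes M :: "complex^'n^'m"
  assumes max: "\<And>x. norm x = 1 \<Longrightarrow> norm (M *v x) \<le> norm (M *v w)" and "norm w = 1"
  shows "ctranspose M ** M *v w = (norm (M *v w))\<^sup>2 *\<^sub>R w"
proof -
  define s where "s = norm (M *v w)"
  define q where "q h = s\<^sup>2 * (h \<bullet> h) - (M *v h) \<bullet> (M *v h)" for h
  have q_nonneg: "q h \<ge> 0" for h
  proof (cases "h = 0")
    case False
    have "norm (M *v (h /\<^sub>R norm h)) \<le> s" using max[of "h /\<^sub>R norm h"] False by (simp add: s_def)
    then have "norm (M *v h) \<le> s * norm h"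
      using False by (simp add: cmatrix_vector_mult_scaleR divide_simps)
    then have "(norm (M *v h))\<^sup>2 \<le> (s * norm h)\<^sup>2" by (intro power_mono) auto
    then show ?thesis by (simp add: q_def power2_norm_eq_inner power_mult_distrib)
  qed (simp add: q_def)
  define g where "g = s\<^sup>2 *\<^sub>R w - ctranspose M ** M *v w"
  have q_w: "q w = 0" using \<open>norm w = 1\<close> by (simp add: q_def s_def dot_square_norm)
  have q_line: "q (w + t *\<^sub>R g) = 2 * t * (g \<bullet> g) + t\<^sup>2 * q g" for t
  proof -
    have gg: "g \<bullet> g = s\<^sup>2 * (w \<bullet> g) - (M *v w) \<bullet> (M *v g)"
      by (metis g_def gram_inner inner_diff_left inner_scaleR_left)
    have "q (w + t *\<^sub>R g) = q w + 2 * t * (s\<^sup>2 * (w \<bullet> g) - (M *v w) \<bullet> (M *v g)) + t\<^sup>2 * q g"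
      unfolding q_def
      by (simp add: matrix_vector_right_distrib cmatrix_vector_mult_scaleR inner_add_left
          inner_add_right inner_commute algebra_simps power2_eq_square)
    then show ?thesis by (simp add: gg q_w)
  qed
  have "g \<bullet> g = 0"
  proof (rule ccontr)
    assume "g \<bullet> g \<noteq> 0"
    then have pos: "g \<bullet> g > 0" by simp
    \<comment> \<open>The denominator \<open>q g + 1\<close> makes the step small enough for the linear term of \<open>q_line\<close> to win.\<close>
    define t where "t = - (g \<bullet> g) / (q g + 1)"
    have "q g + 1 > 0" using q_nonneg[of g] by simp
    then have "t * (q g + 1) = - (g \<bullet> g)" and "t < 0" using pos by (auto simp: t_def divide_simps)
    then have "t * q g = - (g \<bullet> g) - t" by (simp add: algebra_simps)
    then have "t * (t * q g) = t * (- (g \<bullet> g) - t)" by (rule arg_cong)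
    then have "q (w + t *\<^sub>R g) = t * (g \<bullet> g) - t\<^sup>2"
      unfolding q_line power2_eq_square by (simp add: algebra_simps)
    moreover have "\<dots> < 0" using pos \<open>t < 0\<close> by (smt (verit) mult_neg_pos zero_le_power2)
    ultimately show False using q_nonneg[of "w + t *\<^sub>R g"] by simp
  qed
  then show ?thesis by (simp add: g_def s_def)
qed

text \<open>
  Eigenvectors of \<open>M\<^sup>H M\<close> for distinct eigenvalues are orthogonal, and a Euclidean space contains
  only finitely many pairwise orthogonal vectors. Finiteness makes \<open>Max\<close> in \<open>sigma_max\<close> meaningful.
\<close>
lemma finite_singular_values:
  fixes M :: "complex^'n^'m"
  shows "finite {s::real. 0 \<le> s \<and> eigenvalue (ctranspose M ** M) (complex_of_real (s\<^sup>2))}"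
    (is "finite ?E")
proof -
  have "\<forall>s\<in>?E. \<exists>x. x \<noteq> 0 \<and> ctranspose M ** M *v x = s\<^sup>2 *\<^sub>R x"
    by (auto simp: eigenvalue_def of_real_vector_scale simp flip: of_real_power)
  from bchoice[OF this] obtain e where e: "\<And>s. s \<in> ?E \<Longrightarrow> e s \<noteq> 0"
    "\<And>s. s \<in> ?E \<Longrightarrow> ctranspose M ** M *v e s = s\<^sup>2 *\<^sub>R e s" by blast
  have orth: "e s \<bullet> e t = 0" if "s \<in> ?E" "t \<in> ?E" "s \<noteq> t" for s t
  proof -
    have "s\<^sup>2 * (e s \<bullet> e t) = (M *v e s) \<bullet> (M *v e t)"
      using gram_inner[of M "e s" "e t"] e(2)[OF that(1)] by simp
    also have "\<dots> = (M *v e t) \<bullet> (M *v e s)" by (rule inner_commute)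
    also have "\<dots> = t\<^sup>2 * (e t \<bullet> e s)"
      using gram_inner[of M "e t" "e s"] e(2)[OF that(2)] by simp
    finally have "e s \<bullet> e t = 0 \<or> s\<^sup>2 = t\<^sup>2" by (simp add: inner_commute[of "e t" "e s"])
    moreover have "s\<^sup>2 \<noteq> t\<^sup>2" using that by (simp add: power2_eq_iff_nonneg)
    ultimately show ?thesis by blast
  qed
  then have "pairwise orthogonal (e ` ?E)"
    by (auto simp: pairwise_def orthogonal_def)
  then have "finite (e ` ?E)" by (rule pairwise_orthogonal_imp_finite)
  moreover have "inj_on e ?E"
  proof (intro inj_onI, rule ccontr)
    fix s t assume st: "s \<in> ?E" "t \<in> ?E" "e s = e t" "s \<noteq> t"
    then have "e s \<bullet> e s = 0" using orth[OF st(1,2,4)] by simp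
    then show False using e(1)[OF st(1)] by simp
  qed
  ultimately show ?thesis by (rule finite_imageD)
qed

text \<open>
  The maximum and the largest singular value both equal the operator norm \<open>s\<close> of \<open>M\<close>. It is attained at some unit vector \<open>w\<close>, which is
  an eigenvector of \<open>M\<^sup>H M\<close> for \<open>s\<^sup>2\<close>, and no singular value exceeds \<open>s\<close>. The left vector that
  realizes equality is \<open>M w / s\<close>, or any unit vector if \<open>M = 0\<close>.
\<close>
lemma sigma_max_variational:
  fixes M :: "complex^'n^'m"
  shows "norm u = 1 \<Longrightarrow> norm v = 1 \<Longrightarrow> Re (cdot v (M *v u)) \<le> sigma_max M" (is "_ \<Longrightarrow> _ \<Longrightarrow> ?le")
    and "\<exists>u v. norm u = 1 \<and> norm v = 1 \<and> Re (cdot v (M *v u)) = sigma_max M" (is ?att)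
proof -
  let ?E = "{s. 0 \<le> s \<and> eigenvalue (ctranspose M ** M) (complex_of_real (s\<^sup>2))}"
  have "continuous_on (sphere 0 1) (\<lambda>x. norm (M *v x))"
    by (intro continuous_on_norm linear_continuous_on linear_conv_bounded_linear[THEN iffD1]) simp
  moreover have "axis undefined 1 \<in> sphere (0 :: complex^'n) 1" by simp
  ultimately obtain w where w: "norm w = 1" "\<And>x. norm x = 1 \<Longrightarrow> norm (M *v x) \<le> norm (M *v w)"
    using continuous_attains_sup[OF compact_sphere, of 0 1 "\<lambda>x. norm (M *v x)"] by force
  define s where "s = norm (M *v w)"
  have "s \<in> ?E"
  proof -
    have "w \<noteq> 0" using w(1) by auto
    moreover have "ctranspose M ** M *v w = complex_of_real (s\<^sup>2) *s w"
      unfolding of_real_vector_scale s_def by (rule eigenvector_if_norm_maximal[OF w(2) w(1)])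
    ultimately show ?thesis unfolding eigenvalue_def s_def by auto
  qed
  moreover have "t \<le> s" if t: "t \<in> ?E" for t
  proof -
    obtain x where x: "x \<noteq> 0" "ctranspose M ** M *v x = t\<^sup>2 *\<^sub>R x"
      using t by (auto simp: eigenvalue_def of_real_vector_scale simp flip: of_real_power)
    have "(norm (M *v x))\<^sup>2 = (t * norm x)\<^sup>2"
      using gram_inner[of M x x] x(2) by (simp add: power2_norm_eq_inner power_mult_distrib)
    then have "norm (M *v x) = t * norm x" using t by (simp add: power2_eq_iff_nonneg)
    moreover have "norm (M *v (x /\<^sub>R norm x)) \<le> s" using w(2)[of "x /\<^sub>R norm x"] x(1) by (simp add: s_def)
    ultimately show ?thesis using x(1) by (simp add: cmatrix_vector_mult_scaleR field_simps)
  qed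
  ultimately have sig: "sigma_max M = s"
    unfolding sigma_max_def using finite_singular_values[of M] by (intro Max_eqI) auto
  show ?le if "norm u = 1" "norm v = 1"
  proof -
    have "Re (cdot v (M *v u)) \<le> norm v * norm (M *v u)"
      unfolding Re_cdot by (rule norm_cauchy_schwarz)
    then show ?thesis using that w(2)[of u] by (simp add: sig s_def)
  qed
  show ?att
  proof (cases "s = 0")
    case True
    then have "M *v w = 0" by (simp add: s_def)
    then show ?thesis using w(1) True sig
      by (intro exI[of _ w] exI[of _ "axis undefined 1"]) (simp add: Re_cdot)
  next
    case False
    then have "Re (cdot ((M *v w) /\<^sub>R s) (M *v w)) = s"
      by (simp add: Re_cdot s_def dot_square_norm power2_eq_square)
    moreover have "norm ((M *v w) /\<^sub>R s) = 1" using False by (simp add: s_def)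
    ultimately show ?thesis using w(1) sig by blast
  qed
qed

section \<open>Continuity and algebra of matrix operations\<close>

lemma matrix_inv_inverse:
  assumes "invertible M"
  shows "M ** matrix_inv M = mat 1" "matrix_inv M ** M = mat 1"
  using someI_ex[OF assms[unfolded invertible_def]] unfolding matrix_inv_def by auto

lemma continuous_on_det:
  fixes f :: "'a::topological_space \<Rightarrow> 'b::real_normed_field^'n^'n"
  assumes "continuous_on S f"
  shows "continuous_on S (\<lambda>x. det (f x))"
  unfolding det_def by (intro continuous_intros assms)

lemma continuous_on_matrix_mult:
  fixes f :: "'a::topological_space \<Rightarrow> 'b::real_normed_field^'n^'m" and g :: "'a \<Rightarrow> 'b^'p^'n"
  assumes "continuous_on S f" "continuous_on S g"
  shows "continuous_on S (\<lambda>x. f x ** g x)"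
  unfolding matrix_matrix_mult_def by (intro continuous_intros assms)

lemma continuous_on_matrix_vector_mult:
  fixes f :: "'a::topological_space \<Rightarrow> 'b::real_normed_field^'n^'m" and g :: "'a \<Rightarrow> 'b^'n"
  assumes "continuous_on S f" "continuous_on S g"
  shows "continuous_on S (\<lambda>x. f x *v g x)"
  unfolding matrix_vector_mult_def by (intro continuous_intros assms)

text \<open>
  By Cramer's rule the entries of the inverse are quotients of determinants, which are polynomials
  in the entries of the matrix.
\<close>
lemma continuous_on_matrix_inv:
  fixes f :: "'a::topological_space \<Rightarrow> 'b::real_normed_field^'n^'n"
  assumes "continuous_on S f" and inv: "\<And>x. x \<in> S \<Longrightarrow> invertible (f x)"
  shows "continuous_on S (\<lambda>x. matrix_inv (f x))"
proof -
  let ?g = "\<lambda>M::'b^'n^'n. \<chi> k l. det (\<chi> i j. if j = k then axis l 1 $ i else M $ i $ j) / det M"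
  have eq: "matrix_inv M = ?g M" if "invertible M" for M :: "'b^'n^'n"
  proof -
    have "column l (matrix_inv M) = (\<chi> k. ?g M $ k $ l)" for l
    proof -
      have "M *v (matrix_inv M *v axis l 1) = axis l 1"
        by (simp add: matrix_vector_mul_assoc matrix_inv_inverse(1)[OF that])
      moreover have "matrix_inv M *v axis l 1 = column l (matrix_inv M)"
        by (simp add: matrix_vector_mult_def column_def axis_def vec_eq_iff
            if_distrib[of "\<lambda>a. _ * a"] cong: if_cong)
      ultimately show ?thesis
        using cramer[of M "column l (matrix_inv M)" "axis l 1"] that
        by (simp add: invertible_det_nz)
    qed
    then show ?thesis by (simp add: vec_eq_iff column_def)
  qed
  have "continuous_on S (\<lambda>x. \<chi> i j. if j = k then axis l 1 $ i else f x $ i $ j)" for k l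
  proof -
    have "continuous_on S (\<lambda>x. if j = k then axis l 1 $ i else f x $ i $ j)" for i j
      using assms(1) by (cases "j = k") (auto intro!: continuous_intros)
    then show ?thesis by (intro continuous_on_vec_lambda)
  qed
  then have num: "continuous_on S (\<lambda>x. det (\<chi> i j. if j = k then axis l 1 $ i else f x $ i $ j))"
    for k l by (rule continuous_on_det)
  have "continuous_on S (\<lambda>x. det (f x))" by (rule continuous_on_det[OF assms(1)])
  then have "continuous_on S (\<lambda>x. ?g (f x))"
    using inv by (intro continuous_on_vec_lambda continuous_on_divide num)
      (auto simp: invertible_det_nz)
  then show ?thesis using eq inv by (subst continuous_on_cong[OF refl]) auto
qed

lemma continuous_on_map_matrix:
  fixes f :: "'a::topological_space \<Rightarrow> 'b::topological_space^'n^'m"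
    and h :: "'b \<Rightarrow> 'c::topological_space"
  assumes "continuous_on UNIV h" "continuous_on S f"
  shows "continuous_on S (\<lambda>x. map_matrix h (f x))"
  unfolding map_matrix_def
  by (intro continuous_on_vec_lambda continuous_on_compose2[OF assms(1)] continuous_on_component
      assms(2)) auto

lemma continuous_on_cmat: "continuous_on S f \<Longrightarrow> continuous_on S (\<lambda>x. cmat (f x))"
  by (rule continuous_on_map_matrix) (intro continuous_intros)

lemma continuous_on_transpose: "continuous_on S f \<Longrightarrow> continuous_on S (\<lambda>x. transpose (f x))"
  unfolding transpose_def by (intro continuous_on_vec_lambda continuous_on_component)

lemma matrix_diff_rdistrib: "(M - N) ** P = M ** P - N ** P" for M :: "'a::ring_1^'n^'m"
  by (simp add: matrix_matrix_mult_def vec_eq_iff left_diff_distrib sum_subtractf)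

lemma matrix_diff_ldistrib: "M ** (N - P) = M ** N - M ** P" for M :: "'a::ring_1^'n^'m"
  by (simp add: matrix_matrix_mult_def vec_eq_iff right_diff_distrib sum_subtractf)

lemma matrix_add_rdistrib: "(M + N) ** P = M ** P + N ** P" for M :: "'a::ring_1^'n^'m"
  by (simp add: matrix_matrix_mult_def vec_eq_iff distrib_right sum.distrib)

lemma cmat_mult: "cmat (M ** N) = cmat M ** cmat N"
  by (simp add: matrix_matrix_mult_def vec_eq_iff)

lemma cmat_diff: "cmat (M - N) = cmat M - cmat N"
  by (simp add: vec_eq_iff)

text \<open>The resolvent identity, the source of the exact increment formula for the transfer function.\<close>
lemma inverse_difference:
  fixes M N :: "'a::comm_ring_1^'n^'n"
  assumes "invertible M" "invertible N"
  shows "matrix_inv M - matrix_inv N = matrix_inv M ** (N - M) ** matrix_inv N"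
  by (simp add: matrix_diff_ldistrib matrix_diff_rdistrib matrix_inv_inverse assms
      flip: matrix_mul_assoc)

section \<open>Stability and the closed-loop resolvent\<close>

text \<open>
  An eigenvalue \<open>z\<close> with \<open>\<bar>z\<bar> \<ge> 1\<close> is turned into its inverse \<open>c\<close>: instability of \<open>M\<close> means that
  \<open>c M x = x\<close> for some \<open>c\<close> in the closed unit disc and some unit vector \<open>x\<close>. These pairs range over
  a compact set, whereas \<open>z\<close> itself does not, so the unstable matrices are the projection of a closed
  set along a compact one.
\<close>
lemma open_schur_stable: "open {M :: real^'n^'n. schur_stable M}"
proof -
  let ?D = "cball (0::complex) 1 \<times> sphere (0 :: complex^'n) 1"
  let ?T = "{p :: (complex \<times> (complex^'n)) \<times> (real^'n^'n).
      fst (fst p) *s (cmat (snd p) *v snd (fst p)) = snd (fst p)}"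
  have "continuous_on UNIV (\<lambda>p :: (complex \<times> (complex^'n)) \<times> (real^'n^'n).
      fst (fst p) *s (cmat (snd p) *v snd (fst p)))"
    unfolding vector_scalar_mult_def
    by (intro continuous_intros continuous_on_matrix_vector_mult continuous_on_cmat)
  then have "closed ?T"
    by (intro closed_Collect_eq continuous_intros)
  moreover have "compact ?D" by (intro compact_Times) auto
  ultimately have "closed {M. \<exists>p. p \<in> ?D \<and> (p, M) \<in> ?T}"
    by (intro closed_compact_projection)
  also have "{M. \<exists>p. p \<in> ?D \<and> (p, M) \<in> ?T} = - {M :: real^'n^'n. schur_stable M}"
  proof (intro set_eqI iffI)
    fix M :: "real^'n^'n" assume "M \<in> {M. \<exists>p. p \<in> ?D \<and> (p, M) \<in> ?T}"
    then obtain c x where cx: "cmod c \<le> 1" "norm x = 1" "c *s (cmat M *v x) = x" by auto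
    then have "c \<noteq> 0" "x \<noteq> 0" by auto
    then have "cmat M *v x = inverse c *s x"
      using cx(3) by (metis left_inverse vector_smult_assoc vector_smult_lid)
    then have "eigenvalue (cmat M) (inverse c)" using \<open>x \<noteq> 0\<close> by (auto simp: eigenvalue_def)
    moreover have "cmod (inverse c) \<ge> 1"
      using cx(1) \<open>c \<noteq> 0\<close> by (simp add: norm_inverse one_le_inverse)
    ultimately show "M \<in> - {M. schur_stable M}" by (force simp: schur_stable_def)
  next
    fix M :: "real^'n^'n" assume "M \<in> - {M. schur_stable M}"
    then obtain z x where zx: "cmod z \<ge> 1" "x \<noteq> 0" "cmat M *v x = z *s x"
      by (auto simp: schur_stable_def eigenvalue_def not_less)
    then have "z \<noteq> 0" by auto
    let ?x = "x /\<^sub>R norm x"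
    have "inverse z *s (cmat M *v ?x) = ?x"
      using zx(2,3) \<open>z \<noteq> 0\<close>
      by (simp add: cmatrix_vector_mult_scaleR vec_eq_iff scaleR_conv_of_real[where 'a=complex])
    moreover have "norm ?x = 1" "cmod (inverse z) \<le> 1"
      using zx(1,2) by (simp_all add: norm_inverse inverse_le_1_iff)
    ultimately show "M \<in> {M. \<exists>p. p \<in> ?D \<and> (p, M) \<in> ?T}"
      by (intro CollectI exI[of _ "(inverse z, ?x)"]) auto
  qed
  finally show ?thesis by (simp add: closed_def)
qed

lemma open_stabilizing_gains: "open (stabilizing_gains A B C)"
proof -
  have "continuous_on UNIV (\<lambda>K. A + B ** K ** C)"
    by (intro continuous_intros continuous_on_matrix_mult)
  from open_vimage[OF open_schur_stable this] show ?thesis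
    by (simp add: stabilizing_gains_def vimage_def)
qed

lemma invertible_resolvent_matrix:
  assumes "K \<in> stabilizing_gains A B C"
  shows "invertible (mat (exp (\<i> * complex_of_real \<omega>)) - cmat (A + B ** K ** C))"
proof -
  let ?z = "exp (\<i> * complex_of_real \<omega>)" and ?M = "cmat (A + B ** K ** C)"
  have "x = 0" if x: "(mat ?z - ?M) *v x = 0" for x
  proof (rule ccontr)
    assume "x \<noteq> 0"
    have "mat ?z *v x = ?z *s x"
      by (simp add: matrix_vector_mult_def mat_def vec_eq_iff if_distrib[of "\<lambda>a. a * _"] cong: if_cong)
    then have "?M *v x = ?z *s x"
      using x by (simp add: matrix_vector_mult_diff_rdistrib)
    then have "eigenvalue ?M ?z" using \<open>x \<noteq> 0\<close> unfolding eigenvalue_def by blast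
    then have "cmod ?z < 1"
      using assms unfolding stabilizing_gains_def schur_stable_def by blast
    then show False by simp
  qed
  then show ?thesis using matrix_left_invertible_ker invertible_left_inverse by metis
qed

lemma continuous_on_resolvent:
  "continuous_on (UNIV \<times> stabilizing_gains A B C) (\<lambda>(\<omega>, K). resolvent A B C K \<omega>)"
  unfolding resolvent_def split_beta
proof (rule continuous_on_matrix_inv)
  have "continuous_on X (\<lambda>p. mat (exp (\<i> * complex_of_real (fst p))) :: complex^'n^'n)"
    for X :: "(real \<times> (real^'m^'k)) set"
  proof -
    have "continuous_on X (\<lambda>p. if i = j then exp (\<i> * complex_of_real (fst p)) else 0)" for i j :: 'n
      by (cases "i = j") (auto intro!: continuous_intros)
    then show ?thesis unfolding mat_def by (intro continuous_on_vec_lambda)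
  qed
  then show "continuous_on (UNIV \<times> stabilizing_gains A B C)
      (\<lambda>p. mat (exp (\<i> * complex_of_real (fst p))) - cmat (A + B ** snd p ** C))"
    by (intro continuous_on_diff continuous_on_cmat continuous_intros continuous_on_matrix_mult)
qed (auto intro: invertible_resolvent_matrix)

section \<open>The slope of \<open>\<phi>\<close> in the gain\<close>

lemma continuous_on_output_mat: "continuous_on X (output_mat C Q R)"
proof -
  have 1: "continuous_on X (\<lambda>K. (mat_sqrt R ** K ** C) $ b)" for b
    by (intro continuous_on_component continuous_on_matrix_mult continuous_intros)
  show ?thesis
    unfolding output_mat_def vstack_def
  proof (intro continuous_on_vec_lambda)
    fix i show "continuous_on X (\<lambda>K. case i of Inl a \<Rightarrow> mat_sqrt Q $ a | Inr b \<Rightarrow> (mat_sqrt R ** K ** C) $ b)"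
      by (cases i) (simp_all add: 1)
  qed
qed

lemma vstack_zero_mult: "vstack 0 N ** M = vstack 0 (N ** M)"
  by (simp add: vstack_def matrix_matrix_mult_def vec_eq_iff split: sum.split)

lemma output_mat_difference:
  "output_mat C Q R L - output_mat C Q R K = vstack 0 (mat_sqrt R) ** (L - K) ** C"
proof -
  have "vstack 0 (mat_sqrt R) ** (L - K) ** C = vstack 0 (mat_sqrt R ** (L - K) ** C)"
    by (simp add: vstack_zero_mult)
  also have "\<dots> = output_mat C Q R L - output_mat C Q R K"
    by (simp add: output_mat_def vstack_def vec_eq_iff matrix_diff_ldistrib matrix_diff_rdistrib
        split: sum.split)
  finally show ?thesis by simp
qed

text \<open>
  This is \<open>v\<^sup>H M H N u = tr (N u v\<^sup>H M H)\<close>, read as a trace inner product with the real matrix \<open>H\<close>.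
\<close>
lemma bilinear_form_trace:
  "Re (cdot v (M ** cmat H ** N *v u)) = transpose (Re_mat (N ** couter u v ** M)) \<bullet> H"
proof -
  let ?p = "\<lambda>a. \<Sum>i\<in>UNIV. cnj (v $ i) * M $ i $ a"
  let ?q = "\<lambda>b. \<Sum>k\<in>UNIV. N $ b $ k * u $ k"
  have "cdot v (M ** cmat H ** N *v u) = cdot v (M *v (cmat H *v (N *v u)))"
    by (simp add: matrix_vector_mul_assoc matrix_mul_assoc)
  also have "\<dots> = cdot (ctranspose M *v v) (cmat H *v (N *v u))"
    by (rule cdot_matrix_vector_mult)
  also have "\<dots> = (\<Sum>a\<in>UNIV. ?p a * (\<Sum>b\<in>UNIV. complex_of_real (H $ a $ b) * ?q b))"
    by (simp add: cdot_def ctranspose_def transpose_def matrix_vector_mult_def mult.commute)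
  also have "\<dots> = (\<Sum>a\<in>UNIV. \<Sum>b\<in>UNIV. complex_of_real (H $ a $ b) * (?q b * ?p a))"
    by (subst sum_distrib_left) (simp add: ac_simps)
  finally have form: "cdot v (M ** cmat H ** N *v u)
      = (\<Sum>a\<in>UNIV. \<Sum>b\<in>UNIV. complex_of_real (H $ a $ b) * (?q b * ?p a))" .
  have entry: "?q b * ?p a = (N ** couter u v ** M) $ b $ a" for a b
    by (simp add: matrix_matrix_mult_def couter_def sum_distrib_left sum_distrib_right ac_simps)
  have "Re (complex_of_real h * z) = h * Re z" for h z by simp
  then have "Re (cdot v (M ** cmat H ** N *v u))
      = (\<Sum>a\<in>UNIV. \<Sum>b\<in>UNIV. H $ a $ b * Re ((N ** couter u v ** M) $ b $ a))"
    unfolding form entry by (simp only: Re_sum)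
  then show ?thesis
    by (simp add: inner_vec_def transpose_def Re_mat_def mult.commute)
qed

text \<open>
  The gradient formula with the gain split in two: the right resolvent factor keeps the base point
  \<open>K\<close> and the left factor uses the moving gain \<open>L\<close>. This split makes the first-order expansion of
  \<open>phi\<close> exact.
\<close>
definition phi_slope ::
  "real^'x^'x \<Rightarrow> real^'u^'x \<Rightarrow> real^'w^'x \<Rightarrow> real^'x^'y \<Rightarrow> real^'x^'x \<Rightarrow> real^'u^'u
    \<Rightarrow> real^'y^'u \<Rightarrow> real \<times> (complex^'w) \<times> (complex^('x + 'u)) \<Rightarrow> real^'y^'u \<Rightarrow> real^'y^'u" where
  "phi_slope A B Bw C Q R K = (\<lambda>(\<omega>, u, v) L.
     transpose (Re_mat
       (cmat C ** resolvent A B C K \<omega> ** cmat Bw ** couter u v **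
         (cmat (vstack 0 (mat_sqrt R))
           + cmat (output_mat C Q R L) ** resolvent A B C L \<omega> ** cmat B))))"

lemma phi_slope_same: "phi_slope A B Bw C Q R K \<theta> K = grad_phi A B Bw C Q R \<theta> K"
  by (simp add: phi_slope_def grad_phi_def split_beta)

text \<open>
  With \<open>O\<^sub>K\<close> the stacked output matrix and \<open>E\<close> the block column of \<open>0\<close> and \<open>R\<^sup>1\<^sup>/\<^sup>2\<close>, the product rule
  \<open>O\<^sub>L \<Gamma>\<^sub>L - O\<^sub>K \<Gamma>\<^sub>K = (O\<^sub>L - O\<^sub>K) \<Gamma>\<^sub>K + O\<^sub>L (\<Gamma>\<^sub>L - \<Gamma>\<^sub>K)\<close> combined with \<open>O\<^sub>L - O\<^sub>K = E (L - K) C\<close> and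
  the resolvent identity gives \<open>(E + O\<^sub>L \<Gamma>\<^sub>L B) (L - K) C \<Gamma>\<^sub>K\<close>.
\<close>
lemma phi_difference:
  fixes A :: "real^'x^'x" and B :: "real^'u^'x" and Bw :: "real^'w^'x" and C :: "real^'x^'y"
  assumes "K \<in> stabilizing_gains A B C" "L \<in> stabilizing_gains A B C"
  shows "phi A B Bw C Q R \<theta> L - phi A B Bw C Q R \<theta> K = phi_slope A B Bw C Q R K \<theta> L \<bullet> (L - K)"
proof (cases \<theta>)
  case (fields \<omega> u v)
  let ?G = "\<lambda>K. resolvent A B C K \<omega>" and ?O = "\<lambda>K. cmat (output_mat C Q R K)"
  let ?E = "cmat (vstack 0 (mat_sqrt R)) :: complex^'u^('x + 'u)"
  have "?G L - ?G K = ?G L ** (cmat (A + B ** L ** C) - cmat (A + B ** K ** C)) ** ?G K"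
    unfolding resolvent_def
    by (subst inverse_difference) (use assms in \<open>auto intro: invertible_resolvent_matrix\<close>)
  also have "cmat (A + B ** L ** C) - cmat (A + B ** K ** C) = cmat B ** cmat (L - K) ** cmat C"
    by (simp add: matrix_diff_ldistrib matrix_diff_rdistrib flip: cmat_diff cmat_mult)
  finally have G: "?G L - ?G K = ?G L ** (cmat B ** cmat (L - K) ** cmat C) ** ?G K" .
  have O: "?O L - ?O K = ?E ** cmat (L - K) ** cmat C"
    by (simp add: output_mat_difference flip: cmat_diff cmat_mult)
  have "?O L ** ?G L - ?O K ** ?G K = (?O L - ?O K) ** ?G K + ?O L ** (?G L - ?G K)"
    by (simp add: matrix_diff_ldistrib matrix_diff_rdistrib)
  also have "\<dots> = (?E + ?O L ** ?G L ** cmat B) ** cmat (L - K) ** (cmat C ** ?G K)"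
    unfolding G O by (simp add: matrix_add_rdistrib matrix_mul_assoc)
  finally have "T_zw A B Bw C Q R L \<omega> - T_zw A B Bw C Q R K \<omega>
      = (?E + ?O L ** ?G L ** cmat B) ** cmat (L - K) ** (cmat C ** ?G K ** cmat Bw)"
    unfolding T_zw_def by (simp add: matrix_mul_assoc flip: matrix_diff_rdistrib)
  moreover have "phi A B Bw C Q R \<theta> L - phi A B Bw C Q R \<theta> K
      = Re (cdot v ((T_zw A B Bw C Q R L \<omega> - T_zw A B Bw C Q R K \<omega>) *v u))"
    by (simp add: phi_def fields Re_cdot matrix_vector_mult_diff_rdistrib inner_diff_right)
  ultimately have "phi A B Bw C Q R \<theta> L - phi A B Bw C Q R \<theta> K = Re (cdot v
      ((?E + ?O L ** ?G L ** cmat B) ** cmat (L - K) ** (cmat C ** ?G K ** cmat Bw) *v u))"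
    by (simp only:)
  then show ?thesis
    unfolding bilinear_form_trace by (simp add: phi_slope_def fields matrix_mul_assoc)
qed

lemma continuous_on_phi_slope:
  assumes "K \<in> stabilizing_gains A B C"
  shows "continuous_on (X \<times> stabilizing_gains A B C) (\<lambda>(\<theta>, L). phi_slope A B Bw C Q R K \<theta> L)"
proof -
  let ?X = "X \<times> stabilizing_gains A B C"
  have G: "continuous_on ?X (\<lambda>p. resolvent A B C (snd p) (fst (fst p)))"
    using continuous_on_compose2[OF continuous_on_resolvent, of ?X "\<lambda>p. (fst (fst p), snd p)"]
    by (fastforce intro!: continuous_intros simp: split_beta)
  have GK: "continuous_on ?X (\<lambda>p. resolvent A B C K (fst (fst p)))"
    using continuous_on_compose2[OF continuous_on_resolvent[of A B C], of ?X "\<lambda>p. (fst (fst p), K)"] assms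
    by (fastforce intro!: continuous_intros simp: split_beta)
  have O: "continuous_on ?X (\<lambda>p. output_mat C Q R (snd p))"
    by (rule continuous_on_compose2[OF continuous_on_output_mat[of UNIV]]) (auto intro: continuous_intros)
  have uv: "continuous_on ?X (\<lambda>p. couter (fst (snd (fst p))) (snd (snd (fst p))))"
    unfolding couter_def by (intro continuous_intros)
  show ?thesis
    unfolding phi_slope_def Re_mat_def split_beta
    by (intro continuous_on_transpose continuous_on_map_matrix continuous_on_matrix_mult
        continuous_on_add continuous_on_cmat continuous_on_const G GK O uv continuous_on_Re continuous_on_id)
qed

lemma continuous_on_phi:
  assumes "K \<in> stabilizing_gains A B C"
  shows "continuous_on X (\<lambda>\<theta>. phi A B Bw C Q R \<theta> K)"
proof -
  have G: "continuous_on X (\<lambda>\<theta>. resolvent A B C K (fst \<theta>))"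
    using continuous_on_compose2[OF continuous_on_resolvent[of A B C], of X "\<lambda>\<theta>. (fst \<theta>, K)"] assms
    by (fastforce intro!: continuous_intros simp: split_beta)
  show ?thesis
    unfolding phi_def T_zw_def Re_cdot split_beta
    by (intro continuous_on_inner continuous_on_matrix_vector_mult continuous_on_matrix_mult G
        continuous_on_const continuous_on_fst continuous_on_snd continuous_on_id)
qed

section \<open>The cost as a maximum\<close>

lemma compact_Theta: "compact (Theta :: (real \<times> (complex^'w) \<times> (complex^('x::finite + 'u::finite))) set)"
proof -
  have "compact ({0..2*pi} \<times> sphere (0 :: complex^'w) 1 \<times> sphere (0 :: complex^('x + 'u)) 1)"
    by (intro compact_Times) auto
  then show ?thesis by (simp add: Theta_def sphere_def dist_norm)
qed

text \<open>
  The maximum over \<open>\<Theta>\<close> is taken in two stages: for a fixed frequency the unit vectors produce the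
  largest singular value, and a maximizer over all of \<open>\<Theta>\<close>, which exists by compactness, carries the
  frequency at which the supremum in the cost is attained.
\<close>
lemma J_cost_max:
  fixes A :: "real^'x^'x" and B :: "real^'u^'x" and Bw :: "real^'w^'x" and C :: "real^'x^'y"
  assumes K: "K \<in> stabilizing_gains A B C"
  shows "\<theta> \<in> Theta \<Longrightarrow> phi A B Bw C Q R \<theta> K \<le> J_cost A B Bw C Q R K" (is "_ \<Longrightarrow> ?le \<theta>")
    and "\<exists>\<theta>\<in>Theta. phi A B Bw C Q R \<theta> K = J_cost A B Bw C Q R K" (is ?att)
proof -
  let ?\<phi> = "\<lambda>\<theta>. phi A B Bw C Q R \<theta> K" and ?\<sigma> = "\<lambda>\<omega>. sigma_max (T_zw A B Bw C Q R K \<omega>)"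
  have le: "?\<phi> \<theta> \<le> ?\<sigma> (fst \<theta>)" if "\<theta> \<in> Theta" for \<theta>
    using that sigma_max_variational(1) by (auto simp: Theta_def phi_def split_beta)
  have ex: "\<exists>\<theta>\<in>Theta. ?\<phi> \<theta> = ?\<sigma> \<omega>" if \<omega>: "\<omega> \<in> {0..2*pi}" for \<omega>
  proof -
    obtain u v where "norm u = 1" "norm v = 1"
      "Re (cdot v (T_zw A B Bw C Q R K \<omega> *v u)) = ?\<sigma> \<omega>"
      using sigma_max_variational(2) by blast
    then show ?thesis using \<omega> by (intro bexI[of _ "(\<omega>, u, v)"]) (auto simp: Theta_def phi_def)
  qed
  have "Theta \<noteq> ({} :: (real \<times> (complex^'w) \<times> (complex^('x + 'u))) set)"
    using ex[of 0] by auto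
  then obtain \<theta>m where \<theta>m: "\<theta>m \<in> Theta" "\<And>\<theta>. \<theta> \<in> Theta \<Longrightarrow> ?\<phi> \<theta> \<le> ?\<phi> \<theta>m"
    using continuous_attains_sup[OF compact_Theta _ continuous_on_phi[OF K]] by metis
  have \<sigma>_le: "?\<sigma> \<omega> \<le> ?\<phi> \<theta>m" if "\<omega> \<in> {0..2*pi}" for \<omega>
    using ex[OF that] \<theta>m(2) by metis
  have m: "fst \<theta>m \<in> {0..2*pi}" using \<theta>m(1) by (auto simp: Theta_def)
  have "?\<phi> \<theta>m = ?\<sigma> (fst \<theta>m)"
    using le[OF \<theta>m(1)] \<sigma>_le[OF m] by (rule antisym)
  then have "J_cost A B Bw C Q R K = ?\<phi> \<theta>m"
    unfolding J_cost_def using \<sigma>_le m by (intro cSup_eq_maximum) auto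
  then show "\<theta> \<in> Theta \<Longrightarrow> ?le \<theta>" ?att using \<theta>m by auto
qed

section \<open>The subdifferential of the cost\<close>

theorem proposition1:
  fixes A :: "real^'x^'x" and B :: "real^'u^'x" and Bw :: "real^'w^'x" and C :: "real^'x^'y"
    and Q :: "real^'x^'x" and R :: "real^'u^'u" and K :: "real^'y^'u"
  assumes "stabilizable A B"
    and "rank Bw = CARD('x)"
    and "rank C = CARD('y)"
    and "transpose Q = Q" and "transpose R = R"
    and "pos_def Q" and "pos_def R"
    and "stabilizing_gains A B C \<noteq> {}"
    and "K \<in> stabilizing_gains A B C"
  shows "(\<forall>\<theta>\<in>Theta. GDERIV (phi A B Bw C Q R \<theta>) K :> grad_phi A B Bw C Q R \<theta> K)
    \<and> frechet_subdifferential (stabilizing_gains A B C) (J_cost A B Bw C Q R) K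
        = convex hull {grad_phi A B Bw C Q R \<theta> K | \<theta>. \<theta> \<in> Theta0 A B Bw C Q R K}"
proof
  let ?S = "stabilizing_gains A B C"
  note K = \<open>K \<in> ?S\<close>
  show "\<forall>\<theta>\<in>Theta. GDERIV (phi A B Bw C Q R \<theta>) K :> grad_phi A B Bw C Q R \<theta> K"
  proof
    fix \<theta> :: "real \<times> (complex^'w) \<times> (complex^('x + 'u))"
    have "continuous_on ?S (phi_slope A B Bw C Q R K \<theta>)"
    proof -
      have "continuous_on ?S (\<lambda>L. (\<theta>, L))" by (intro continuous_intros)
      from continuous_on_compose2[OF continuous_on_phi_slope[OF K, of UNIV] this]
      show ?thesis by auto
    qed
    from GDERIV_if_slope[OF open_stabilizing_gains K this phi_difference[OF K]]
    show "GDERIV (phi A B Bw C Q R \<theta>) K :> grad_phi A B Bw C Q R \<theta> K"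
      by (simp add: phi_slope_same)
  qed
  have "frechet_subdifferential ?S (J_cost A B Bw C Q R) K = convex hull
      {phi_slope A B Bw C Q R K \<theta> K | \<theta>. \<theta> \<in> Theta \<and> phi A B Bw C Q R \<theta> K = J_cost A B Bw C Q R K}"
  proof (rule frechet_subdifferential_max[where P = "phi_slope A B Bw C Q R K"
        and \<phi> = "phi A B Bw C Q R", OF compact_Theta open_stabilizing_gains K])
    show "continuous_on (Theta \<times> ?S) (\<lambda>(\<theta>, L). phi_slope A B Bw C Q R K \<theta> L)"
      by (rule continuous_on_phi_slope[OF K])
  qed (rule phi_difference[OF K] continuous_on_phi[OF K] J_cost_max; assumption)+
  then show "frechet_subdifferential ?S (J_cost A B Bw C Q R) K
        = convex hull {grad_phi A B Bw C Q R \<theta> K | \<theta>. \<theta> \<in> Theta0 A B Bw C Q R K}"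
    unfolding phi_slope_same Theta0_def mem_Collect_eq .
qed

end
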